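(* Let $G$ and $H$ be arbitrary graphs and define $$\Gamma_1(G,H)=\min_{p}\ \max_{v\in\mathcal V(G)} \frac{1}{\mathbb{E}[|F(v)|]},$$ where the minimum is over all probability distributions $p$ on the (finite) set $\mathcal F(H,G)$, $F$ is a random element of $\mathcal F(H,G)$ distributed according to $p$, and $1/0=\infty$. Then for every natural number $n$, $$\alpha(G^{\boxtimes n})\le \alpha(H^{\boxtimes n})\,\Gamma_1(G,H)^n .$$
   Context: All graphs are finite, simple, undirected. $\alpha(G)$ is the independence number. The strong product $G\boxtimes H$ has vertex set $\mathcal V(G)\times\mathcal V(H)$, with distinct $(u,u'),(v,v')$ adjacent iff ($u=v$ or $uv\in\mathcal E(G)$) and ($u'=v'$ or $u'v'\in\mathcal E(H)$); $G^{\boxtimes n}$ is the $n$-fold strong power. $\mathcal I(H)$ denotes the set of all independent sets of $H$, including $\emptyset$. Two sets $\mathcal S,\mathcal T\in\mathcal I(H)$ are called disconnected in $H$ if $\mathcal S\cap\mathcal T=\emptyset$ and $\mathcal S\cup\mathcal T\in\mathcal I(H)$. $\mathcal F(H,G)$ is the set of functions $f:\mathcal V(G)\to\mathcal I(H)$ such that for distinct vertices $v_1,v_2$ of $G$ with no edge between them in $G$, the sets $f(v_1)$ and $f(v_2)$ are disconnected in $H$. *)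

theory Defs
  imports "HOL-Probability.Probability" "Graph_Theory.Pair_Digraph"
begin

text \<open>
  A finite simple undirected graph is a \<^const>\<open>pair_graph\<close>: a finite loop-free symmetric
  digraph without parallel arcs. An undirected edge $uv$ is the pair of arcs
  $(u, v)$ and $(v, u)$.
\<close>

definition independent_sets :: "'a pair_pre_digraph \<Rightarrow> 'a set set" where
  "independent_sets G = {S. S \<subseteq> pverts G \<and> (\<forall>u\<in>S. \<forall>v\<in>S. (u, v) \<notin> parcs G)}"

definition independence_number :: "'a pair_pre_digraph \<Rightarrow> nat" where
  "independence_number G = Max (card ` independent_sets G)"

definition strong_prod ::
    "'a pair_pre_digraph \<Rightarrow> 'b pair_pre_digraph \<Rightarrow> ('a \<times> 'b) pair_pre_digraph" where
  "strong_prod G H =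
    \<lparr> pverts = pverts G \<times> pverts H,
      parcs = {((u, u'), (v, v')) | u u' v v'.
        (u, u') \<in> pverts G \<times> pverts H \<and> (v, v') \<in> pverts G \<times> pverts H \<and>
        (u, u') \<noteq> (v, v') \<and>
        (u = v \<or> (u, v) \<in> parcs G) \<and> (u' = v' \<or> (u', v') \<in> parcs H)} \<rparr>"

text \<open>
  Since the type of iterated pairs depends on the number of factors, the vertices of a strong
  power are represented by lists: a vertex $(x, xs)$ of the product of $G$ with its $n$-th power
  is renamed to the list \<^term>\<open>x # xs\<close>. The 0-th power is the one-vertex graph.
\<close>

primrec strong_power :: "'a pair_pre_digraph \<Rightarrow> nat \<Rightarrow> 'a list pair_pre_digraph" where
  "strong_power G 0 = \<lparr> pverts = {[]}, parcs = {} \<rparr>"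
| "strong_power G (Suc n) =
    (let P = strong_prod G (strong_power G n); r = (\<lambda>(x, xs). x # xs)
     in \<lparr> pverts = r ` pverts P, parcs = map_prod r r ` parcs P \<rparr>)"

definition disconnected :: "'a pair_pre_digraph \<Rightarrow> 'a set \<Rightarrow> 'a set \<Rightarrow> bool" where
  "disconnected H S T \<longleftrightarrow> S \<inter> T = {} \<and> S \<union> T \<in> independent_sets H"

text \<open>
  The functions are extensional (\<^term>\<open>undefined\<close> outside \<^term>\<open>pverts G\<close>), so that functions
  on the vertex set are not counted several times and the set is finite for finite graphs.
\<close>

definition indep_maps ::
    "'b pair_pre_digraph \<Rightarrow> 'a pair_pre_digraph \<Rightarrow> ('a \<Rightarrow> 'b set) set" where
  "indep_maps H G =
    {f \<in> pverts G \<rightarrow>\<^sub>E independent_sets H.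
      \<forall>v\<^sub>1\<in>pverts G. \<forall>v\<^sub>2\<in>pverts G.
        v\<^sub>1 \<noteq> v\<^sub>2 \<and> (v\<^sub>1, v\<^sub>2) \<notin> parcs G \<longrightarrow> disconnected H (f v\<^sub>1) (f v\<^sub>2)}"

text \<open>In \<^typ>\<open>ennreal\<close> the quotient \<^term>\<open>1 / 0 :: ennreal\<close> is \<^term>\<open>\<infinity> :: ennreal\<close>.\<close>

definition max_recip_expectation :: "'a pair_pre_digraph \<Rightarrow> ('a \<Rightarrow> 'b set) pmf \<Rightarrow> ennreal" where
  "max_recip_expectation G p =
    (SUP v\<in>pverts G. 1 / ennreal (measure_pmf.expectation p (\<lambda>f. real (card (f v)))))"

text \<open>
  The infimum below is a minimum for finite graphs, see \<open>Gamma1_attained\<close>. The supremum above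
  is over a finite set, hence a maximum if \<^term>\<open>G\<close> has a vertex, and it is 0 otherwise.
\<close>

definition Gamma1 :: "'a pair_pre_digraph \<Rightarrow> 'b pair_pre_digraph \<Rightarrow> ennreal" where
  "Gamma1 G H = (INF p\<in>{p. set_pmf p \<subseteq> indep_maps H G}. max_recip_expectation G p)"

lemma pair_graphI:
  assumes "finite (pverts G)" "parcs G \<subseteq> pverts G \<times> pverts G"
    and "\<And>u v. (u, v) \<in> parcs G \<Longrightarrow> (v, u) \<in> parcs G" "\<And>u. (u, u) \<notin> parcs G"
  shows "pair_graph G"
proof -
  have "finite (parcs G)"
    using assms(1,2) by (meson finite_SigmaI finite_subset)
  then show ?thesis
    using assms by unfold_locales (auto simp: symmetric_def sym_def)
qed

lemma pair_graph_strong_prod: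
  assumes "pair_graph G" "pair_graph H"
  shows "pair_graph (strong_prod G H)"
proof -
  interpret G: pair_graph G by fact
  interpret H: pair_graph H by fact
  have "(v, u) \<in> parcs G" if "(u, v) \<in> parcs G" for u v
    using G.pair_sym_arcs that by (auto simp: symmetric_def sym_def)
  moreover have "(v, u) \<in> parcs H" if "(u, v) \<in> parcs H" for u v
    using H.pair_sym_arcs that by (auto simp: symmetric_def sym_def)
  ultimately show ?thesis
    using G.pair_finite_verts H.pair_finite_verts
    by (intro pair_graphI) (auto simp: strong_prod_def)
qed

lemma pair_graph_image:
  assumes "pair_graph P" "inj r"
  shows "pair_graph \<lparr> pverts = r ` pverts P, parcs = map_prod r r ` parcs P \<rparr>"
proof -
  interpret P: pair_graph P by fact
  show ?thesis
  proof (intro pair_graphI, goal_cases)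
    case 1
    show ?case using P.pair_finite_verts by simp
  next
    case 2
    show ?case
    proof clarsimp
      fix a b assume "(a, b) \<in> parcs P"
      then show "r a \<in> r ` pverts P \<and> r b \<in> r ` pverts P"
        using P.arc_fst_in_verts[of "(a, b)"] P.arc_snd_in_verts[of "(a, b)"] by simp
    qed
  next
    case (3 u v)
    then obtain a b where ab: "u = r a" "v = r b" "(a, b) \<in> parcs P" by auto
    then have "(b, a) \<in> parcs P" using P.pair_sym_arcs by (simp add: symmetric_def symD)
    then have "map_prod r r (b, a) \<in> map_prod r r ` parcs P" by (rule imageI)
    then show ?case using ab by simp
  next
    case (4 u)
    show ?case
    proof
      assume "(u, u) \<in> parcs \<lparr> pverts = r ` pverts P, parcs = map_prod r r ` parcs P \<rparr>"
      then obtain a b where "r a = r b" "(a, b) \<in> parcs P" by auto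
      then show False using P.pair_no_loops[of "(a, b)"] injD[OF assms(2)] by simp
    qed
  qed
qed

lemma pair_graph_strong_power:
  assumes "pair_graph G"
  shows "pair_graph (strong_power G n)"
proof (induction n)
  case 0
  show ?case by (intro pair_graphI) auto
next
  case (Suc n)
  have "inj (\<lambda>(x, xs). x # xs)" by (auto simp: inj_def)
  from pair_graph_image[OF pair_graph_strong_prod[OF assms Suc] this]
  show ?case by (simp add: Let_def)
qed

lemma strong_power_verts:
  "pverts (strong_power G n) = {xs. length xs = n \<and> set xs \<subseteq> pverts G}"
  by (induction n) (auto simp: strong_prod_def Let_def length_Suc_conv image_iff)

lemma strong_power_arcs:
  "(xs, ys) \<in> parcs (strong_power G n) \<longleftrightarrow>
     xs \<in> pverts (strong_power G n) \<and> ys \<in> pverts (strong_power G n) \<and> xs \<noteq> ys \<and>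
     (\<forall>i<n. xs ! i = ys ! i \<or> (xs ! i, ys ! i) \<in> parcs G)"
proof (induction n arbitrary: xs ys)
  case 0
  show ?case by simp
next
  case (Suc n)
  have arcs: "(xs, ys) \<in> parcs (strong_power G (Suc n)) \<longleftrightarrow>
    (\<exists>x xs' y ys'. xs = x # xs' \<and> ys = y # ys' \<and> x \<in> pverts G \<and> y \<in> pverts G \<and>
      xs' \<in> pverts (strong_power G n) \<and> ys' \<in> pverts (strong_power G n) \<and>
      xs \<noteq> ys \<and> (x = y \<or> (x, y) \<in> parcs G) \<and>
      (xs' = ys' \<or> (xs', ys') \<in> parcs (strong_power G n)))"
    by (force simp: strong_prod_def Let_def image_iff)
  have eq: "xs' = ys' \<or> (xs', ys') \<in> parcs (strong_power G n) \<longleftrightarrow>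
      (\<forall>i<n. xs' ! i = ys' ! i \<or> (xs' ! i, ys' ! i) \<in> parcs G)"
    if "xs' \<in> pverts (strong_power G n)" "ys' \<in> pverts (strong_power G n)" for xs' ys'
    using that by (auto simp: Suc)
  show ?case
  proof (cases "xs \<in> pverts (strong_power G (Suc n)) \<and> ys \<in> pverts (strong_power G (Suc n))")
    case True
    then obtain x xs' y ys' where *: "xs = x # xs'" "ys = y # ys'" "x \<in> pverts G" "y \<in> pverts G"
        "xs' \<in> pverts (strong_power G n)" "ys' \<in> pverts (strong_power G n)"
      by (auto simp: strong_power_verts length_Suc_conv simp del: strong_power.simps)
    show ?thesis
      using True * eq[OF *(5,6)] unfolding arcs by (simp add: All_less_Suc2 del: strong_power.simps)
  next
    case False
    then show ?thesis
      unfolding arcs strong_power_verts by auto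
  qed
qed

lemma finite_indep_maps:
  assumes "pair_graph G" "pair_graph H"
  shows "finite (indep_maps H G)"
proof -
  interpret G: pair_graph G by fact
  interpret H: pair_graph H by fact
  have "finite (independent_sets H)"
    using H.pair_finite_verts
    by (rule finite_subset[rotated, OF iffD2[OF finite_Pow_iff]]) (auto simp: independent_sets_def)
  then have "finite (pverts G \<rightarrow>\<^sub>E independent_sets H)"
    using G.pair_finite_verts by (intro finite_PiE) auto
  then show ?thesis
    by (rule finite_subset[rotated]) (auto simp: indep_maps_def)
qed

lemma Gamma1_attained:
  assumes "pair_graph G" "pair_graph H"
  shows "\<exists>p. set_pmf p \<subseteq> indep_maps H G \<and> Gamma1 G H = max_recip_expectation G p"
proof -
  interpret G: pair_graph G by fact
  define F where "F = indep_maps H G"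
  have fin: "finite F"
    unfolding F_def by (rule finite_indep_maps) fact+
  have "(\<lambda>v\<in>pverts G. {}) \<in> F"
    by (auto simp: F_def indep_maps_def independent_sets_def disconnected_def)
  then obtain f0 where f0: "f0 \<in> F" ..
  define B where "B = (PiE UNIV (\<lambda>f. if f \<in> F then {0..1} else {0}) :: (_ \<Rightarrow> real) set)"
  define S where "S = B \<inter> {q. sum q F = 1}"
  have "compactin (product_topology (\<lambda>_. euclideanreal) UNIV) B"
    unfolding B_def compactin_PiE by auto
  then have "compact B"
    by (simp add: euclidean_product_topology)
  moreover have "closed {q :: _ \<Rightarrow> real. sum q F = 1}"
    by (intro closed_Collect_eq continuous_intros continuous_on_product_coordinates)
  ultimately have "compact S"
    unfolding S_def by (rule compact_Int_closed)
  define val :: "(_ \<Rightarrow> real) \<Rightarrow> ennreal" where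
    "val q = (SUP v\<in>pverts G. 1 / ennreal (\<Sum>f\<in>F. q f * real (card (f v))))" for q
  have term_cont: "continuous_on S (\<lambda>q. 1 / ennreal (\<Sum>f\<in>F. q f * real (card (f v))))" for v
    unfolding divide_ennreal_def mult_1
    by (intro continuous_on_inverse_ennreal continuous_on_ennreal continuous_intros
        continuous_on_subset[OF continuous_on_product_coordinates subset_UNIV])
  have "continuous_on S (\<lambda>q. SUP v\<in>V. 1 / ennreal (\<Sum>f\<in>F. q f * real (card (f v))))"
    if "finite V" for V
    using that
  proof (induction V)
    case empty
    show ?case by (simp add: continuous_on_const)
  next
    case (insert v V)
    then show ?case
      by (simp add: sup_max continuous_on_max term_cont)
  qed
  then have cont: "continuous_on S val"
    unfolding val_def using G.pair_finite_verts by blast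
  have pmf_S: "pmf p \<in> S \<and> max_recip_expectation G p = val (pmf p)" if "set_pmf p \<subseteq> F" for p
  proof
    have "sum (pmf p) F = 1"
      using sum_pmf_eq_1[OF fin that] .
    then show "pmf p \<in> S"
      using that by (auto simp: S_def B_def pmf_le_1 set_pmf_iff)
    have "measure_pmf.expectation p (\<lambda>f. real (card (f v)))
        = (\<Sum>f\<in>F. pmf p f * real (card (f v)))" for v
      using that by (subst integral_measure_pmf_real[OF fin]) (auto simp: mult.commute)
    then show "max_recip_expectation G p = val (pmf p)"
      by (simp add: max_recip_expectation_def val_def)
  qed
  have "S \<noteq> {}"
    using pmf_S[of "return_pmf f0"] f0 by auto
  then obtain q where q: "q \<in> S" "\<And>q'. q' \<in> S \<Longrightarrow> val q \<le> val q'"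
    using continuous_attains_inf[OF \<open>compact S\<close> _ cont] by blast
  have nonneg: "0 \<le> q f" for f
    using q(1) by (auto simp: S_def B_def PiE_def Pi_def split: if_splits dest!: spec[of _ f])
  have zero: "q f = 0" if "f \<notin> F" for f
    using q(1) that by (auto simp: S_def B_def PiE_def Pi_def dest!: spec[of _ f])
  have "(\<integral>\<^sup>+f. ennreal (q f) \<partial>count_space UNIV) = (\<Sum>f\<in>F. ennreal (q f))"
    using fin zero by (intro nn_integral_count_space') auto
  also have "\<dots> = 1"
    using q(1) nonneg by (subst sum_ennreal) (auto simp: S_def)
  finally have int: "(\<integral>\<^sup>+f. ennreal (q f) \<partial>count_space UNIV) = 1" .
  define p where "p = embed_pmf q"
  have pmf: "pmf p = q"
    unfolding p_def by (rule ext) (rule pmf_embed_pmf[OF nonneg int])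
  have supp: "set_pmf p \<subseteq> F"
    using zero by (auto simp: set_pmf_eq pmf)
  have "Gamma1 G H = max_recip_expectation G p"
    unfolding Gamma1_def F_def[symmetric]
  proof (rule antisym)
    show "(INF p\<in>{p. set_pmf p \<subseteq> F}. max_recip_expectation G p) \<le> max_recip_expectation G p"
      using supp by (intro INF_lower) auto
    show "max_recip_expectation G p \<le> (INF p\<in>{p. set_pmf p \<subseteq> F}. max_recip_expectation G p)"
      using pmf_S q(2) supp pmf by (intro INF_greatest) simp
  qed
  then show ?thesis
    using supp by (auto simp: F_def)
qed

end

theory Submission
  imports Defs
begin

text \<open>
  Let \<open>S\<close> be a largest independent set of the \<open>n\<close>-th power of \<open>G\<close> and choose maps
  \<open>f\<^sub>1, \<dots>, f\<^sub>n\<close>. Distinct \<open>v, w\<close> in \<open>S\<close> have a coordinate \<open>i\<close> at which they are distinct and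
  non-adjacent, so \<open>f\<^sub>i v\<^sub>i\<close> and \<open>f\<^sub>i w\<^sub>i\<close> are disconnected; hence the boxes
  \<open>f\<^sub>1 v\<^sub>1 \<times> \<dots> \<times> f\<^sub>n v\<^sub>n\<close> for \<open>v\<close> in \<open>S\<close> are disjoint and their union is independent in the
  \<open>n\<close>-th power of \<open>H\<close>. Averaging the resulting bound on the total size of the boxes over
  independent \<open>f\<^sub>i\<close> drawn from an optimal distribution gives the claim.
\<close>

lemma finite_independent_sets: "finite (pverts G) \<Longrightarrow> finite (independent_sets G)"
  by (rule finite_subset[of _ "Pow (pverts G)"]) (auto simp: independent_sets_def)

lemma card_le_independence_number:
  assumes "finite (pverts G)" "S \<in> independent_sets G"
  shows "card S \<le> independence_number G"
  unfolding independence_number_def using assms by (auto simp: finite_independent_sets)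

lemma independence_number_attained:
  assumes "finite (pverts G)"
  obtains S where "S \<in> independent_sets G" "card S = independence_number G"
proof -
  have "{} \<in> independent_sets G" by (simp add: independent_sets_def)
  then have "Max (card ` independent_sets G) \<in> card ` independent_sets G"
    using assms by (intro Max_in) (auto simp: finite_independent_sets)
  then show ?thesis
    using that unfolding independence_number_def by force
qed

text \<open>The Cartesian product of the \<open>A i\<close>, encoded by lists so that boxes are sets
  of vertices of a strong power.\<close>

definition list_box :: "nat \<Rightarrow> (nat \<Rightarrow> 'a set) \<Rightarrow> 'a list set" where
  "list_box n A = {xs. length xs = n \<and> (\<forall>i<n. xs ! i \<in> A i)}"

lemma list_box_Suc:
  "list_box (Suc n) A = (\<lambda>(x, xs). x # xs) ` (A 0 \<times> list_box n (\<lambda>i. A (Suc i)))"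
  by (force simp: list_box_def length_Suc_conv All_less_Suc2)

lemma card_list_box: "card (list_box n A) = (\<Prod>i<n. card (A i))"
proof (induction n arbitrary: A)
  case 0
  have "list_box 0 A = {[]}" by (auto simp: list_box_def)
  then show ?case by simp
next
  case (Suc n)
  have "inj_on (\<lambda>(x, xs). x # xs) (A 0 \<times> list_box n (\<lambda>i. A (Suc i)))"
    by (auto simp: inj_on_def)
  then show ?case
    unfolding list_box_Suc
    by (simp only: card_image card_cartesian_product Suc prod.lessThan_Suc_shift o_def)
qed

text \<open>The deterministic bound, before averaging. The map may vary with the coordinate, as
  independent sampling requires.\<close>

lemma sum_card_boxes_le:
  assumes H: "pair_graph H"
    and S: "S \<in> independent_sets (strong_power G n)"
    and f: "\<And>i. i < n \<Longrightarrow> f i \<in> indep_maps H G"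
  shows "(\<Sum>v\<in>S. \<Prod>i<n. card (f i (v ! i))) \<le> independence_number (strong_power H n)"
proof (cases "finite S")
  \<comment> \<open>A sum over an infinite set is 0 by convention.\<close>
  case False
  then show ?thesis by simp
next
  case True
  define T where "T v = list_box n (\<lambda>i. f i (v ! i))" for v
  interpret P: pair_graph "strong_power H n" by (rule pair_graph_strong_power[OF H])
  have fin: "finite (pverts (strong_power H n))" by (rule P.pair_finite_verts)
  have V: "length v = n \<and> set v \<subseteq> pverts G" if "v \<in> S" for v
    using S that by (auto simp: independent_sets_def strong_power_verts)
  have fv: "f i (v ! i) \<in> independent_sets H" if "v \<in> S" "i < n" for v i
  proof -
    have "v ! i \<in> pverts G" using V[OF that(1)] that(2) by (auto dest: nth_mem)
    then show ?thesis using f[OF that(2)] by (auto simp: indep_maps_def PiE_def Pi_def)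
  qed
  have T_verts: "T v \<subseteq> pverts (strong_power H n)" if "v \<in> S" for v
    using fv[OF that]
    by (fastforce simp: T_def list_box_def strong_power_verts independent_sets_def in_set_conv_nth)
  have sep: "\<exists>i<n. disconnected H (f i (v ! i)) (f i (w ! i))"
    if vw: "v \<in> S" "w \<in> S" "v \<noteq> w" for v w
  proof -
    have "(v, w) \<notin> parcs (strong_power G n)" "v \<in> pverts (strong_power G n)"
        "w \<in> pverts (strong_power G n)"
      using S vw by (auto simp: independent_sets_def)
    then obtain i where i: "i < n" "v ! i \<noteq> w ! i" "(v ! i, w ! i) \<notin> parcs G"
      using vw(3) by (auto simp: strong_power_arcs)
    moreover have "v ! i \<in> pverts G" "w ! i \<in> pverts G"
      using V[OF vw(1)] V[OF vw(2)] i(1) by (auto dest: nth_mem)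
    ultimately show ?thesis using f[OF i(1)] by (auto simp: indep_maps_def)
  qed
  have disj: "T v \<inter> T w = {}" if "v \<in> S" "w \<in> S" "v \<noteq> w" for v w
    using sep[OF that] by (auto simp: T_def list_box_def disconnected_def)
  have nonadj: "(x, y) \<notin> parcs (strong_power H n)"
    if "v \<in> S" "w \<in> S" "x \<in> T v" "y \<in> T w" for v w x y
  proof
    assume "(x, y) \<in> parcs (strong_power H n)"
    then have "x \<noteq> y" and adj: "\<And>i. i < n \<Longrightarrow> x ! i = y ! i \<or> (x ! i, y ! i) \<in> parcs H"
      by (auto simp: strong_power_arcs)
    have mem: "x ! i \<in> f i (v ! i)" "y ! i \<in> f i (w ! i)" if "i < n" for i
      using \<open>x \<in> T v\<close> \<open>y \<in> T w\<close> that by (auto simp: T_def list_box_def)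
    show False
    proof (cases "v = w")
      case True
      \<comment> \<open>Within one box, \<open>x ! i\<close> and \<open>y ! i\<close> lie in the
        same independent set, so they cannot be adjacent and must agree.\<close>
      have "x ! i = y ! i" if "i < n" for i
        using adj[OF that] mem[OF that] fv[OF \<open>v \<in> S\<close> that] True
        by (auto simp: independent_sets_def)
      moreover have "length x = n" "length y = n"
        using \<open>x \<in> T v\<close> \<open>y \<in> T w\<close> by (auto simp: T_def list_box_def)
      ultimately show False using \<open>x \<noteq> y\<close> by (auto intro: nth_equalityI)
    next
      case False
      from sep[OF \<open>v \<in> S\<close> \<open>w \<in> S\<close> False] obtain i
        where "i < n" "disconnected H (f i (v ! i)) (f i (w ! i))" by blast
      \<comment> \<open>Disjointness excludes equality at \<open>i\<close>, and independence of the
        union excludes adjacency.\<close>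
      with adj[of i] mem[of i] show False
        by (auto simp: disconnected_def independent_sets_def)
    qed
  qed
  have "(\<Union>v\<in>S. T v) \<in> independent_sets (strong_power H n)"
    using T_verts nonadj unfolding independent_sets_def by blast
  then have "card (\<Union>v\<in>S. T v) \<le> independence_number (strong_power H n)"
    by (rule card_le_independence_number[OF fin])
  moreover have "card (\<Union>v\<in>S. T v) = (\<Sum>v\<in>S. card (T v))"
    using True T_verts disj by (intro card_UN_disjoint) (auto intro: finite_subset[OF _ fin])
  ultimately show ?thesis by (simp add: T_def card_list_box)
qed

text \<open>The product measure on \<open>n\<close>-tuples of maps stays implicit: expanding a
  product of finite sums gives a sum over tuples \<open>\<phi>\<close>, each weighted by the product
  of its probabilities.\<close>

lemma sum_prod_expectation_le:
  assumes G: "pair_graph G" and H: "pair_graph H"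
    and S: "S \<in> independent_sets (strong_power G n)"
    and p: "set_pmf p \<subseteq> indep_maps H G"
  shows "(\<Sum>v\<in>S. \<Prod>i<n. measure_pmf.expectation p (\<lambda>f. real (card (f (v ! i)))))
    \<le> real (independence_number (strong_power H n))"
proof -
  let ?F = "indep_maps H G"
  let ?\<Phi> = "{..<n} \<rightarrow>\<^sub>E ?F"
  let ?a = "real (independence_number (strong_power H n))"
  have fin: "finite ?F" by (rule finite_indep_maps[OF G H])
  have E: "measure_pmf.expectation p (\<lambda>f. real (card (f x)))
      = (\<Sum>f\<in>?F. pmf p f * real (card (f x)))" for x
    using p by (subst integral_measure_pmf_real[OF fin]) (auto simp: mult.commute)
  have "(\<Sum>v\<in>S. \<Prod>i<n. measure_pmf.expectation p (\<lambda>f. real (card (f (v ! i)))))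
      = (\<Sum>v\<in>S. \<Sum>\<phi>\<in>?\<Phi>. \<Prod>i<n. pmf p (\<phi> i) * real (card (\<phi> i (v ! i))))"
    unfolding E using fin by (subst prod_sum_PiE) auto
  \<comment> \<open>For a fixed tuple the inner sum is now the total size of its boxes.\<close>
  also have "\<dots> = (\<Sum>\<phi>\<in>?\<Phi>. (\<Prod>i<n. pmf p (\<phi> i)) * real (\<Sum>v\<in>S. \<Prod>i<n. card (\<phi> i (v ! i))))"
    by (subst sum.swap) (simp add: prod.distrib sum_distrib_left)
  also have "\<dots> \<le> (\<Sum>\<phi>\<in>?\<Phi>. (\<Prod>i<n. pmf p (\<phi> i)) * ?a)"
    by (intro sum_mono mult_left_mono of_nat_mono sum_card_boxes_le[OF H S] prod_nonneg)
      (auto simp: PiE_def Pi_def)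
  also have "\<dots> = (\<Prod>i<n. \<Sum>f\<in>?F. pmf p f) * ?a"
    using fin by (subst prod_sum_PiE) (auto simp: sum_distrib_right)
  also have "\<dots> = ?a"
    by (simp add: sum_pmf_eq_1[OF fin p])
  finally show ?thesis .
qed

text \<open>Serves the case of infinite \<open>Gamma1\<close>: since 0 times infinity is 0 in
  \<open>ennreal\<close>, the right-hand side is infinite only if this factor is positive.\<close>

lemma independence_number_strong_power_pos:
  assumes "pair_graph H" "pverts H \<noteq> {}"
  shows "0 < independence_number (strong_power H n)"
proof -
  interpret P: pair_graph "strong_power H n" by (rule pair_graph_strong_power) fact
  from assms(2) obtain x where "x \<in> pverts H" by blast
  then have "{replicate n x} \<in> independent_sets (strong_power H n)"
    by (auto simp: independent_sets_def strong_power_verts strong_power_arcs)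
  then have "card {replicate n x} \<le> independence_number (strong_power H n)"
    by (rule card_le_independence_number[OF P.pair_finite_verts])
  then show ?thesis by simp
qed

lemma independence_number_strong_power_0: "independence_number (strong_power G 0) = 1"
proof -
  have "independent_sets (strong_power G 0) = {{}, {[]}}"
    by (auto simp: independent_sets_def)
  then show ?thesis by (simp add: independence_number_def)
qed

theorem theorem1:
  fixes G :: "'a pair_pre_digraph" and H :: "'b pair_pre_digraph" and n :: nat
  assumes "pair_graph G" and "pair_graph H" and "pverts H \<noteq> {}"
  shows "of_nat (independence_number (strong_power G n))
    \<le> of_nat (independence_number (strong_power H n)) * Gamma1 G H ^ n"
proof (cases "n = 0 \<or> Gamma1 G H = \<top>")
  \<comment> \<open>For \<open>n = 0\<close> both sides are 1, even if \<open>Gamma1\<close> is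
    infinite; for positive \<open>n\<close> and infinite \<open>Gamma1\<close> the right-hand side
    is infinite.\<close>
  case True
  show ?thesis
  proof (cases "n = 0")
    case True
    then show ?thesis by (simp only: independence_number_strong_power_0) simp
  next
    case False
    with True independence_number_strong_power_pos[OF assms(2,3), of n] show ?thesis
      by (simp add: ennreal_mult_top ennreal_mult_eq_top_iff top_power_ennreal)
  qed
next
  case False
  then have M: "Gamma1 G H < \<top>" by (simp add: less_top)
  obtain p where p: "set_pmf p \<subseteq> indep_maps H G" "Gamma1 G H = max_recip_expectation G p"
    using Gamma1_attained[OF assms(1,2)] by blast
  define e where "e x = measure_pmf.expectation p (\<lambda>f. real (card (f x)))" for x
  have e_nonneg: "0 \<le> e x" for x
    unfolding e_def by (rule integral_nonneg_AE) simp
  have one_le: "1 \<le> Gamma1 G H * ennreal (e x)" if "x \<in> pverts G" for x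
  proof -
    have le: "1 / ennreal (e x) \<le> Gamma1 G H"
      unfolding p(2) max_recip_expectation_def e_def using that by (intro SUP_upper)
    \<comment> \<open>Otherwise the reciprocal would be infinite, against finiteness of
      \<open>Gamma1\<close>.\<close>
    have "ennreal (e x) \<noteq> 0"
      using le M by (auto simp: divide_ennreal_def top_unique)
    then have "0 < e x" using e_nonneg[of x] by (auto simp: less_le)
    then have "1 = 1 / ennreal (e x) * ennreal (e x)"
      by (simp add: divide_ennreal_def inverse_ennreal flip: ennreal_mult)
    also have "\<dots> \<le> Gamma1 G H * ennreal (e x)"
      by (rule mult_right_mono[OF le]) simp
    finally show ?thesis .
  qed
  interpret P: pair_graph "strong_power G n" by (rule pair_graph_strong_power) fact
  obtain S where S: "S \<in> independent_sets (strong_power G n)"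
      "card S = independence_number (strong_power G n)"
    using independence_number_attained[OF P.pair_finite_verts] .
  \<comment> \<open>Each vertex of \<open>S\<close> counts as a product of \<open>n\<close> ones, so
    that \<open>one_le\<close> applies coordinate by coordinate.\<close>
  have "of_nat (card S) = (\<Sum>v\<in>S. \<Prod>i<n. 1 :: ennreal)" by simp
  also have "\<dots> \<le> (\<Sum>v\<in>S. \<Prod>i<n. Gamma1 G H * ennreal (e (v ! i)))"
    using S(1) by (intro sum_mono prod_mono_ennreal one_le)
      (auto simp: independent_sets_def strong_power_verts dest!: subsetD)
  also have "\<dots> = Gamma1 G H ^ n * (\<Sum>v\<in>S. \<Prod>i<n. ennreal (e (v ! i)))"
    by (simp add: prod.distrib sum_distrib_left)
  also have "(\<Sum>v\<in>S. \<Prod>i<n. ennreal (e (v ! i))) = ennreal (\<Sum>v\<in>S. \<Prod>i<n. e (v ! i))"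
    by (simp add: prod_ennreal sum_ennreal e_nonneg prod_nonneg)
  also have "Gamma1 G H ^ n * \<dots> \<le> Gamma1 G H ^ n * ennreal (independence_number (strong_power H n))"
    using sum_prod_expectation_le[OF assms(1,2) S(1) p(1)]
    by (intro mult_left_mono ennreal_leI) (simp_all add: e_def)
  finally show ?thesis
    by (simp add: S(2) mult.commute ennreal_of_nat_eq_real_of_nat)
qed

end
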